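(* Let $I=[0,1]$, let $T:I\to I$ be a piecewise expanding map as described in the context, with $\lambda=\sup_i\sup_{x\in T(A_i)}|D(T_{|A_i})^{-1}(x)|<1$, and let $\gamma\in[0,1]$ satisfy $\gamma<1-\lambda$. For every $n\ge 2$ let $\hat T:I^n\to I^n$ be the coupled map lattice with $n$ sites $$\hat T(\overline{x})_i=(1-\gamma)T(x_i)+\frac{\gamma}{n}\sum_{j=1}^nT(x_j),\qquad i\in\{1,\dots,n\}.$$ Fix $p\ge 1$. If, for each $n$, $\overline{z}^{(p)}_n\in I^n$ is a periodic point of $\hat T$ of prime period $p$, then its extremal index $\theta_n(\overline{z}^{(p)}_n)$ satisfies $$\lim_{n\to\infty}\theta_n(\overline{z}^{(p)}_n)=1.$$
   Context: The local map $T$ maps $I=[0,1]$ onto itself and is piecewise expanding with finitely many branches: $I$ is divided into finitely many intervals $A_1,\dots,A_q$ with disjoint interiors, and on the interior of each $A_i$ the map $T$ is injective and of class $C^2$, extended by continuity (together with its derivatives) to the boundary of $A_i$. The number $\lambda:=\sup_i\sup_{x\in T(A_i)}|D(T_{|A_i})^{-1}(x)|$ satisfies $\lambda<1$ (so $|T'|\ge 1/\lambda$ wherever $T'$ is defined). The extremal index (EI) of a periodic point $\overline{z}\in I^n$ of $\hat T$ of prime period $p$ is $$\theta_n(\overline{z})=1-\frac{1}{|\det D(\hat T^{p})(\overline{z})|},$$ where $D(\hat T^p)(\overline z)$ is the Jacobian matrix of $\hat T^p$ at $\overline z$; it is understood that $T$ is differentiable at all coordinates of all points of the orbit of $\overline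 z$. *)

theory Defs
  imports "HOL-Analysis.Analysis" "Jordan_Normal_Form.Determinant"
begin

text \<open>
  The number of sites varies in the limit, so points of \<open>I^n\<close> are dimension-carrying vectors
  (theory \<open>Jordan_Normal_Form.Matrix\<close>) with coordinates indexed by \<open>0..<n\<close>. The interval
  \<open>I = [0,1]\<close> is the whole phase space of \<open>T\<close>; differentiability of \<open>T\<close> is therefore always taken
  relative to it, which is one-sided at \<open>0\<close> and \<open>1\<close> and two-sided elsewhere.
\<close>

section \<open>Piecewise expanding interval maps\<close>

text \<open>
  \<open>branch T A\<close> is the restriction of \<open>T\<close> to the interior of \<open>A\<close>, extended by continuity to \<open>A\<close>.
  At an endpoint of \<open>A\<close> it may differ from the value of \<open>T\<close> there.
\<close>

definition branch :: "(real \<Rightarrow> real) \<Rightarrow> real set \<Rightarrow> real \<Rightarrow> real" where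
  "branch T A x = (if x \<in> interior A then T x else Lim (at x within interior A) T)"

definition inv_branch :: "(real \<Rightarrow> real) \<Rightarrow> real set \<Rightarrow> real \<Rightarrow> real" where
  "inv_branch T A = inv_into A (branch T A)"

definition inv_branch_deriv :: "(real \<Rightarrow> real) \<Rightarrow> real set \<Rightarrow> real \<Rightarrow> real" where
  "inv_branch_deriv T A y =
     vector_derivative (inv_branch T A) (at y within branch T A ` A)"

text \<open>\<open>T\<close> is \<open>C\<^sup>2\<close> on the interior of \<open>A\<close> and, with its derivatives, extends continuously to \<open>A\<close>.\<close>

definition C2_branch :: "(real \<Rightarrow> real) \<Rightarrow> real set \<Rightarrow> bool" where
  "C2_branch T A \<longleftrightarrow>
     continuous_on A (branch T A) \<and>
     (\<exists>T1 T2. continuous_on A T1 \<and> continuous_on A T2 \<and>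
        (\<forall>x\<in>interior A. (T has_real_derivative T1 x) (at x) \<and>
                         (T1 has_real_derivative T2 x) (at x)))"

definition contraction_const :: "(real \<Rightarrow> real) \<Rightarrow> real set set \<Rightarrow> real" where
  "contraction_const T \<A> = (SUP A\<in>\<A>. SUP y\<in>branch T A ` A. \<bar>inv_branch_deriv T A y\<bar>)"

text \<open>
  The supremum defining \<open>contraction_const\<close> is a real one, so that the derivatives of the inverse
  branches exist and that the supremum is finite is stated explicitly. The library's divisions
  admit degenerate intervals, which are excluded here.
\<close>

definition piecewise_expanding :: "(real \<Rightarrow> real) \<Rightarrow> real set set \<Rightarrow> bool" where
  "piecewise_expanding T \<A> \<longleftrightarrow>
     T ` {0..1} = {0..1} \<and>
     \<A> division_of {0..1} \<and>
     (\<forall>A\<in>\<A>. interior A \<noteq> {} \<and> inj_on T (interior A) \<and> C2_branch T A \<and>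
        inv_branch T A differentiable_on branch T A ` A \<and>
        bdd_above ((\<lambda>y. \<bar>inv_branch_deriv T A y\<bar>) ` branch T A ` A)) \<and>
     contraction_const T \<A> < 1"

section \<open>Coupled map lattices\<close>

definition unit_cube :: "nat \<Rightarrow> real Matrix.vec set" where
  "unit_cube n = {x \<in> carrier_vec n. \<forall>i<n. vec_index x i \<in> {0..1}}"

definition cml :: "(real \<Rightarrow> real) \<Rightarrow> real \<Rightarrow> nat \<Rightarrow> real Matrix.vec \<Rightarrow> real Matrix.vec" where
  "cml T \<gamma> n x = Matrix.vec n (\<lambda>i.
     (1 - \<gamma>) * T (vec_index x i) + \<gamma> / real n * (\<Sum>j<n. T (vec_index x j)))"

definition prime_periodic_point :: "('a \<Rightarrow> 'a) \<Rightarrow> nat \<Rightarrow> 'a \<Rightarrow> bool" where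
  "prime_periodic_point F p z \<longleftrightarrow>
     0 < p \<and> (F ^^ p) z = z \<and> (\<forall>k. 0 < k \<and> k < p \<longrightarrow> (F ^^ k) z \<noteq> z)"

definition differentiable_along_orbit ::
    "(real \<Rightarrow> real) \<Rightarrow> real \<Rightarrow> nat \<Rightarrow> nat \<Rightarrow> real Matrix.vec \<Rightarrow> bool" where
  "differentiable_along_orbit T \<gamma> n p z \<longleftrightarrow>
     (\<forall>k<p. \<forall>i<n. T differentiable (at (vec_index ((cml T \<gamma> n ^^ k) z) i) within {0..1}))"

text \<open>The Jacobian matrix of a self-map of the unit cube: entry \<open>(i, j)\<close> is the partial derivative
  of the \<open>i\<close>-th component in the \<open>j\<close>-th coordinate, taken within the cube.\<close>

definition jacobian ::
    "nat \<Rightarrow> (real Matrix.vec \<Rightarrow> real Matrix.vec) \<Rightarrow> real Matrix.vec \<Rightarrow> real Matrix.mat" where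
  "jacobian n F z = Matrix.mat n n (\<lambda>(i, j).
     vector_derivative (\<lambda>t. vec_index (F (update_vec z j t)) i)
       (at (vec_index z j) within {0..1}))"

definition extremal_index ::
    "(real \<Rightarrow> real) \<Rightarrow> real \<Rightarrow> nat \<Rightarrow> nat \<Rightarrow> real Matrix.vec \<Rightarrow> real" where
  "extremal_index T \<gamma> n p z = 1 - 1 / \<bar>Determinant.det (jacobian n (cml T \<gamma> n ^^ p) z)\<bar>"

end

theory Submission
  imports Defs
begin

text \<open>
  The extremal index tends to \<open>1\<close> because the Jacobian determinant of the \<open>p\<close>-th iterate grows
  exponentially with the number \<open>n\<close> of sites.

  One step of the lattice applies \<open>T\<close> at every site and then the linear averaging map
  \<open>(1 - \<gamma>) I + (\<gamma> / n) J\<close>, where \<open>J\<close> is the matrix with all entries \<open>1\<close>. The averaging map is the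
  identity on constant vectors and multiplication by \<open>1 - \<gamma>\<close> on vectors of mean zero, so it has
  determinant \<open>(1 - \<gamma>) ^ (n - 1)\<close>. Hence the Jacobian determinant of one step at \<open>x\<close> is
  \<open>(1 - \<gamma>) ^ (n - 1) * (\<Prod>j<n. T' (x\<^sub>j))\<close> (lemma \<open>det_cml_jacobian\<close>). By the chain rule the determinant
  for \<open>p\<close> steps is the product of these along the orbit (lemmas \<open>jacobian_cml_funpow\<close> and
  \<open>det_orbit_jacobian\<close>).

  With \<open>\<lambda>\<close> the contraction constant, \<open>\<bar>T'\<bar> \<ge> 1 / \<lambda>\<close> wherever \<open>T\<close> is differentiable (lemma
  \<open>piecewise_expanding_derivative\<close>). Every step therefore contributes at least
  \<open>((1 - \<gamma>) / \<lambda>) ^ (n - 1)\<close> in absolute value, and \<open>\<gamma> < 1 - \<lambda>\<close> says exactly that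
  \<open>(1 - \<gamma>) / \<lambda> > 1\<close>. So the determinant of the whole orbit is at least as large as this single
  power, whatever \<open>p\<close> and the orbits are.
\<close>

section \<open>The derivative of the local map\<close>

text \<open>
  Continuity and injectivity make \<open>f\<close> strictly monotone on the open interval, and by continuity it
  is then strictly monotone up to the endpoints.
\<close>

lemma inj_on_closed_interval:
  fixes f :: "real \<Rightarrow> real"
  assumes cont: "continuous_on {a..b} f" and inj: "inj_on f {a<..<b}"
  shows "inj_on f {a..b}"
proof -
  \<comment> \<open>Two interior points \<open>u < v\<close> between \<open>x\<close> and \<open>y\<close> give \<open>g x \<le> g u < g v \<le> g y\<close>, the outer
    inequalities by continuity.\<close>
  have strict: "g x < g y"
    if g: "continuous_on {a..b} g" "strict_mono_on {a<..<b} g" and xy: "a \<le> x" "x < y" "y \<le> b"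
    for g :: "real \<Rightarrow> real" and x y
  proof -
    obtain u where u: "x < u" "u < y" using dense xy by blast
    obtain v where v: "u < v" "v < y" using dense u by blast
    have "g x \<le> g u"
    proof (rule continuous_le_on_closure[where f = g and S = "{x<..<u}"])
      show "continuous_on (closure {x<..<u}) g"
        using u xy by (intro continuous_on_subset[OF g(1)]) auto
      show "x \<in> closure {x<..<u}" using u by simp
      show "g t \<le> g u" if "t \<in> {x<..<u}" for t
        using strict_mono_onD[OF g(2), of t u] that u xy by force
    qed
    also have "g u < g v"
      using strict_mono_onD[OF g(2), of u v] u v xy by force
    also have "g v \<le> g y"
    proof (rule continuous_ge_on_closure[where f = g and S = "{v<..<y}"])
      show "continuous_on (closure {v<..<y}) g"
        using u v xy by (intro continuous_on_subset[OF g(1)]) auto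
      show "y \<in> closure {v<..<y}" using v by simp
      show "g v \<le> g t" if "t \<in> {v<..<y}" for t
        using strict_mono_onD[OF g(2), of v t] that u v xy by force
    qed
    finally show ?thesis .
  qed
  have "continuous_on {a<..<b} f"
    by (rule continuous_on_subset[OF cont]) auto
  then have "strict_mono_on {a<..<b} f \<or> strict_antimono_on {a<..<b} f"
    using inj injective_eq_monotone_map[of "{a<..<b}" f] by (simp add: is_interval_oo)
  then have "strict_mono_on {a<..<b} f \<or> strict_mono_on {a<..<b} (\<lambda>x. - f x)"
    by (auto simp: monotone_on_def)
  then show ?thesis
  proof
    assume "strict_mono_on {a<..<b} f"
    from strict[OF cont this] show ?thesis
      by (intro linorder_inj_onI) (auto, force)
  next
    assume "strict_mono_on {a<..<b} (\<lambda>x. - f x)"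
    from strict[OF continuous_on_minus[OF cont] this] show ?thesis
      by (intro linorder_inj_onI) (auto, force)
  qed
qed

text \<open>
  The chain rule for the inverse branch composed with the branch. It extends to the endpoints of
  \<open>A\<close>: differentiability of \<open>T\<close> at such a point makes \<open>T\<close> continuous there, so the branch, defined
  by a limit from inside, takes the value of \<open>T\<close>. Injectivity of the branch on the closed interval
  ensures that the inverse branch, a choice of preimage in \<open>A\<close>, returns to \<open>x\<close>.
\<close>

lemma inv_branch_derivative_inverse:
  fixes x d :: real
  assumes A: "A = {a..b}" "a < b"
    and cont: "continuous_on A (branch T A)"
    and inj: "inj_on T (interior A)"
    and diff: "inv_branch T A differentiable_on branch T A ` A"
    and x: "x \<in> A"
    and sub: "A \<subseteq> S"
    and T: "(T has_real_derivative d) (at x within S)"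
  shows "inv_branch_deriv T A (branch T A x) * d = 1"
proof -
  let ?f = "branch T A" and ?g = "inv_branch T A"
  \<comment> \<open>On \<open>?B\<close> the branch coincides with \<open>T\<close>; on all of \<open>A\<close> it may differ at an endpoint other
    than \<open>x\<close>.\<close>
  let ?B = "insert x {a<..<b}"
  have int: "interior A = {a<..<b}" using A by simp
  have f_int: "?f t = T t" if "t \<in> {a<..<b}" for t
    using that by (simp add: branch_def int)
  have inj_f: "inj_on ?f A"
  proof -
    have "inj_on ?f {a<..<b} \<longleftrightarrow> inj_on T {a<..<b}"
      by (rule inj_on_cong) (rule f_int)
    then show ?thesis
      using inj_on_closed_interval[of a b ?f] cont inj int by (simp add: A(1))
  qed
  have lim: "x islimpt {a<..<b}"
    using x A limpt_of_closure[of x "{a<..<b}"] by (simp add: islimpt_Icc)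
  have "(T \<longlongrightarrow> T x) (at x within S)"
    using T by (metis DERIV_continuous continuous_within)
  then have "(T \<longlongrightarrow> T x) (at x within {a<..<b})"
    by (rule tendsto_within_subset) (use sub A in auto)
  then have f_x: "?f x = T x"
    using lim by (simp add: branch_def int tendsto_Lim trivial_limit_within)
  have BA: "?B \<subseteq> A" using x A by auto
  have "(T has_real_derivative d) (at x within ?B)"
    by (rule DERIV_subset[OF T]) (use BA sub in auto)
  then have f: "(?f has_real_derivative d) (at x within ?B)"
    by (rule has_field_derivative_transform_within[where d = 1]) (auto simp: f_x f_int)
  have "(?g has_real_derivative inv_branch_deriv T A (?f x)) (at (?f x) within ?f ` A)"
    using diff x unfolding differentiable_on_def inv_branch_deriv_def
    by (simp add: vector_derivative_works has_real_derivative_iff_has_vector_derivative)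
  then have g: "(?g has_real_derivative inv_branch_deriv T A (?f x)) (at (?f x) within ?f ` ?B)"
    by (rule DERIV_subset) (use BA in auto)
  have "((?g \<circ> ?f) has_real_derivative inv_branch_deriv T A (?f x) * d) (at x within ?B)"
    by (rule DERIV_image_chain[OF g f])
  moreover have "((?g \<circ> ?f) has_real_derivative 1) (at x within ?B)"
    by (rule has_field_derivative_transform_within[where f = "\<lambda>t. t" and d = 1])
       (use BA inj_f in \<open>auto simp: inv_branch_def\<close>)
  moreover have "at x within ?B \<noteq> bot"
    using lim by (simp add: trivial_limit_within islimpt_insert)
  ultimately show ?thesis
    using vector_derivative_unique_within
    unfolding has_real_derivative_iff_has_vector_derivative by blast
qed

text \<open>
  The expansion bound \<open>\<bar>T'\<bar> \<ge> 1 / \<lambda>\<close>. The product form also forces the contraction constant to be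
  positive as soon as \<open>T\<close> is differentiable at a single point.
\<close>

lemma piecewise_expanding_derivative:
  assumes T: "piecewise_expanding T \<A>"
    and x: "x \<in> {0..1}"
    and d: "(T has_real_derivative d) (at x within {0..1})"
  shows "1 \<le> contraction_const T \<A> * \<bar>d\<bar>"
proof -
  have div: "\<A> division_of {0..1}"
    and props: "\<And>A. A \<in> \<A> \<Longrightarrow> interior A \<noteq> {} \<and> inj_on T (interior A) \<and> C2_branch T A \<and>
        inv_branch T A differentiable_on branch T A ` A \<and>
        bdd_above ((\<lambda>y. \<bar>inv_branch_deriv T A y\<bar>) ` branch T A ` A)"
    using T unfolding piecewise_expanding_def by auto
  obtain A where A: "A \<in> \<A>" "x \<in> A"
    using division_ofD(6)[OF div] x by blast
  obtain a b where ab: "A = {a..b}"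
    using division_ofD(4)[OF div A(1)] by auto
  then have "a < b"
    using props[OF A(1)] by (simp add: ab)
  have "inv_branch_deriv T A (branch T A x) * d = 1"
  proof (rule inv_branch_derivative_inverse[OF ab \<open>a < b\<close>])
    show "A \<subseteq> {0..1}" using division_ofD(2)[OF div A(1)] .
  qed (use props[OF A(1)] A d in \<open>auto simp: C2_branch_def\<close>)
  then have "1 = \<bar>inv_branch_deriv T A (branch T A x)\<bar> * \<bar>d\<bar>"
    by (metis abs_mult abs_one)
  also have "\<bar>inv_branch_deriv T A (branch T A x)\<bar> \<le> contraction_const T \<A>"
  proof -
    have "\<bar>inv_branch_deriv T A (branch T A x)\<bar>
        \<le> (SUP y\<in>branch T A ` A. \<bar>inv_branch_deriv T A y\<bar>)"
      by (rule cSUP_upper) (use A props[OF A(1)] in auto)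
    also have "\<dots> \<le> contraction_const T \<A>"
      unfolding contraction_const_def
      by (rule cSUP_upper) (use A division_of_finite[OF div] in auto)
    finally show ?thesis .
  qed
  finally show ?thesis by (simp add: mult_right_mono)
qed

section \<open>The Jacobian determinant of the coupled map lattice\<close>

text \<open>
  The Weinstein--Aronszajn identity: multiplying the block matrix \<open>?M\<close> of the proof by the
  unitriangular \<open>?L\<close> on the right clears its lower left block and leaves \<open>1 + U V\<close>, while
  multiplying on the left leaves \<open>1 + V U\<close>.
\<close>

lemma det_one_plus_mult_swap:
  fixes U V :: "'a :: idom mat"
  assumes U: "U \<in> carrier_mat n m" and V: "V \<in> carrier_mat m n"
  shows "Determinant.det (1\<^sub>m n + U * V) = Determinant.det (1\<^sub>m m + V * U)"
proof -
  let ?M = "four_block_mat (1\<^sub>m n) (- U) V (1\<^sub>m m)"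
  let ?L = "four_block_mat (1\<^sub>m n) (0\<^sub>m n m) (- V) (1\<^sub>m m)"
  have M: "?M \<in> carrier_mat (n + m) (n + m)" and L: "?L \<in> carrier_mat (n + m) (n + m)"
    by auto
  have det_L: "Determinant.det ?L = 1"
    by (subst det_four_block_mat_upper_right_zero) (use V in auto)
  have "?M * ?L = four_block_mat (1\<^sub>m n + U * V) (- U) (0\<^sub>m m n) (1\<^sub>m m)"
    by (subst mult_four_block_mat[of _ n n _ m _ m _ _ n _ m]) (use U V in auto)
  then have "Determinant.det (?M * ?L) = Determinant.det (1\<^sub>m n + U * V)"
    using U V by (simp add: det_four_block_mat_lower_left_zero[of _ n _ m])
  moreover have "?L * ?M = four_block_mat (1\<^sub>m n) (- U) (0\<^sub>m m n) (1\<^sub>m m + V * U)"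
    using U V by (subst mult_four_block_mat[of _ n n _ m _ m _ _ n _ m]) (auto simp: comm_add_mat[of _ m m])
  then have "Determinant.det (?L * ?M) = Determinant.det (1\<^sub>m m + V * U)"
    using U V by (simp add: det_four_block_mat_lower_left_zero[of _ n _ m])
  ultimately show ?thesis
    using det_mult[OF M L] det_mult[OF L M] det_L by simp
qed

text \<open>
  The matrix is \<open>a (1 + U V)\<close> with a column \<open>U\<close> of ones and a constant row \<open>V\<close>, so swapping the
  factors reduces it to a matrix with one entry.
\<close>

lemma det_constant_plus_diagonal:
  fixes a c :: "'a :: field"
  assumes "a \<noteq> 0"
  shows "Determinant.det (Matrix.mat n n (\<lambda>(i, j). (if i = j then a else 0) + c))
    = a ^ n * (1 + of_nat n * (c / a))"
proof -
  let ?U = "Matrix.mat n 1 (\<lambda>_. 1)" and ?V = "Matrix.mat 1 n (\<lambda>_. c / a)"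
  have "Matrix.mat n n (\<lambda>(i, j). (if i = j then a else 0) + c) = a \<cdot>\<^sub>m (1\<^sub>m n + ?U * ?V)"
    using assms by (intro eq_matI) (auto simp: scalar_prod_def field_simps)
  moreover have "Determinant.det (1\<^sub>m n + ?U * ?V) = Determinant.det (1\<^sub>m 1 + ?V * ?U)"
    by (rule det_one_plus_mult_swap) auto
  moreover have "\<dots> = 1 + of_nat n * (c / a)"
    by (subst det_single) (auto simp: scalar_prod_def)
  ultimately show ?thesis by simp
qed

text \<open>
  The averaging matrix \<open>(1 - \<gamma>) I + (\<gamma> / n) J\<close> with its columns scaled by the derivatives of \<open>T\<close>,
  taken within the phase space as for \<open>jacobian\<close>.
\<close>

definition cml_jacobian :: "(real \<Rightarrow> real) \<Rightarrow> real \<Rightarrow> nat \<Rightarrow> real Matrix.vec \<Rightarrow> real Matrix.mat" where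
  "cml_jacobian T \<gamma> n x = Matrix.mat n n (\<lambda>(i, j).
     ((if i = j then 1 - \<gamma> else 0) + \<gamma> / real n) *
       vector_derivative T (at (vec_index x j) within {0..1}))"

lemma cml_jacobian_carrier [simp]: "cml_jacobian T \<gamma> n x \<in> carrier_mat n n"
  by (simp add: cml_jacobian_def)

lemma det_cml_jacobian:
  assumes "\<gamma> \<noteq> 1" and "0 < n"
  shows "Determinant.det (cml_jacobian T \<gamma> n x)
    = (1 - \<gamma>) ^ (n - 1) * (\<Prod>j<n. vector_derivative T (at (vec_index x j) within {0..1}))"
proof -
  let ?d = "\<lambda>j. vector_derivative T (at (vec_index x j) within {0..1})"
  let ?C = "Matrix.mat n n (\<lambda>(i, j). (if i = j then 1 - \<gamma> else 0) + \<gamma> / real n)"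
  have "cml_jacobian T \<gamma> n x = ?C * mat_diag n ?d"
    by (subst mat_diag_mult_right[of _ n]) (auto simp: cml_jacobian_def)
  then have "Determinant.det (cml_jacobian T \<gamma> n x)
      = Determinant.det ?C * Determinant.det (mat_diag n ?d)"
    using det_mult[of ?C n "mat_diag n ?d"] by simp
  also have "Determinant.det (mat_diag n ?d) = (\<Prod>j<n. ?d j)"
    by (subst det_upper_triangular[of _ n])
       (auto simp: mat_diag_def upper_triangular_def prod_list_diag_prod lessThan_atLeast0)
  also have "Determinant.det ?C = (1 - \<gamma>) ^ n * (1 + real n * (\<gamma> / real n / (1 - \<gamma>)))"
    using assms by (subst det_constant_plus_diagonal) auto
  also have "1 + real n * (\<gamma> / real n / (1 - \<gamma>)) = 1 / (1 - \<gamma>)"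
    using assms by (simp add: field_simps)
  also have "(1 - \<gamma>) ^ n * (1 / (1 - \<gamma>)) = (1 - \<gamma>) ^ (n - 1)"
    using assms by (cases n) auto
  finally show ?thesis .
qed

lemma cml_carrier [simp]: "cml T \<gamma> n x \<in> carrier_vec n"
  by (simp add: cml_def)

lemma cml_unit_cube:
  assumes T: "T ` {0..1} \<subseteq> {0..1}" and \<gamma>: "0 \<le> \<gamma>" "\<gamma> \<le> 1" and x: "x \<in> unit_cube n"
  shows "cml T \<gamma> n x \<in> unit_cube n"
proof -
  have Tx: "0 \<le> T (vec_index x j) \<and> T (vec_index x j) \<le> 1" if "j < n" for j
    using x T that by (auto simp: unit_cube_def image_subset_iff)
  have "0 \<le> (1 - \<gamma>) * T (vec_index x i) + \<gamma> / real n * (\<Sum>j<n. T (vec_index x j)) \<and>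
        (1 - \<gamma>) * T (vec_index x i) + \<gamma> / real n * (\<Sum>j<n. T (vec_index x j)) \<le> 1"
    if i: "i < n" for i
  proof
    show "0 \<le> (1 - \<gamma>) * T (vec_index x i) + \<gamma> / real n * (\<Sum>j<n. T (vec_index x j))"
      using Tx i \<gamma> by (intro add_nonneg_nonneg mult_nonneg_nonneg sum_nonneg) auto
    have "(\<Sum>j<n. T (vec_index x j)) \<le> real n"
      using sum_bounded_above[of "{..<n}" "\<lambda>j. T (vec_index x j)" 1] Tx by simp
    then have "\<gamma> / real n * (\<Sum>j<n. T (vec_index x j)) \<le> \<gamma> / real n * real n"
      using \<gamma> by (intro mult_left_mono) auto
    moreover have "(1 - \<gamma>) * T (vec_index x i) \<le> (1 - \<gamma>) * 1"
      using Tx i \<gamma> by (intro mult_left_mono) auto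
    ultimately show "(1 - \<gamma>) * T (vec_index x i) + \<gamma> / real n * (\<Sum>j<n. T (vec_index x j)) \<le> 1"
      using i by simp
  qed
  then show ?thesis by (simp add: unit_cube_def cml_def)
qed

lemma cml_funpow_unit_cube:
  assumes "T ` {0..1} \<subseteq> {0..1}" "0 \<le> \<gamma>" "\<gamma> \<le> 1" "x \<in> unit_cube n"
  shows "(cml T \<gamma> n ^^ k) x \<in> unit_cube n"
  by (induction k) (use assms cml_unit_cube in auto)

text \<open>
  The lattice map sends the velocity \<open>v\<close> of a curve in the cube to the Jacobian applied to \<open>v\<close>.
  Differentiating along curves, rather than in all coordinates at once, is enough to iterate: the
  image of a coordinate line is already a curve of this kind, and only one-dimensional derivatives
  are needed, also at the boundary of the cube.
\<close>

lemma cml_curve_derivative: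
  assumes c: "\<And>i. i < n \<Longrightarrow> ((\<lambda>t. vec_index (c t) i) has_real_derivative v i) (at s within S)"
    and cube: "\<And>t. t \<in> S \<Longrightarrow> c t \<in> unit_cube n"
    and T: "\<And>i. i < n \<Longrightarrow> T differentiable (at (vec_index (c s) i) within {0..1})"
    and i: "i < n"
  shows "((\<lambda>t. vec_index (cml T \<gamma> n (c t)) i) has_real_derivative
           (\<Sum>j<n. cml_jacobian T \<gamma> n (c s) $$ (i, j) * v j)) (at s within S)"
proof -
  let ?d = "\<lambda>j. vector_derivative T (at (vec_index (c s) j) within {0..1})"
  have Tc: "((\<lambda>t. T (vec_index (c t) j)) has_real_derivative ?d j * v j) (at s within S)"
    if j: "j < n" for j
  proof -
    have "(T has_real_derivative ?d j) (at (vec_index (c s) j) within {0..1})"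
      using T[OF j]
      by (simp add: vector_derivative_works has_real_derivative_iff_has_vector_derivative)
    then have "(T has_real_derivative ?d j)
        (at (vec_index (c s) j) within (\<lambda>t. vec_index (c t) j) ` S)"
      by (rule DERIV_subset) (use cube j in \<open>auto simp: unit_cube_def\<close>)
    from DERIV_image_chain[OF this c[OF j]] show ?thesis
      by (simp add: o_def)
  qed
  have "((\<lambda>t. (1 - \<gamma>) * T (vec_index (c t) i) + \<gamma> / real n * (\<Sum>j<n. T (vec_index (c t) j)))
      has_real_derivative (1 - \<gamma>) * (?d i * v i) + \<gamma> / real n * (\<Sum>j<n. ?d j * v j)) (at s within S)"
    using i by (intro DERIV_add DERIV_cmult DERIV_sum Tc) auto
  moreover have "(1 - \<gamma>) * (?d i * v i) + \<gamma> / real n * (\<Sum>j<n. ?d j * v j)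
      = (\<Sum>j<n. cml_jacobian T \<gamma> n (c s) $$ (i, j) * v j)"
  proof -
    have "(\<Sum>j<n. cml_jacobian T \<gamma> n (c s) $$ (i, j) * v j)
        = (\<Sum>j<n. (if i = j then (1 - \<gamma>) * (?d j * v j) else 0) + \<gamma> / real n * (?d j * v j))"
      using i by (intro sum.cong) (auto simp: cml_jacobian_def algebra_simps)
    then show ?thesis
      using i by (simp add: sum.distrib sum_distrib_left)
  qed
  ultimately show ?thesis using i by (simp add: cml_def)
qed

fun orbit_jacobian ::
    "(real \<Rightarrow> real) \<Rightarrow> real \<Rightarrow> nat \<Rightarrow> real Matrix.vec \<Rightarrow> nat \<Rightarrow> real Matrix.mat" where
  "orbit_jacobian T \<gamma> n z 0 = 1\<^sub>m n"
| "orbit_jacobian T \<gamma> n z (Suc k) =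
     cml_jacobian T \<gamma> n ((cml T \<gamma> n ^^ k) z) * orbit_jacobian T \<gamma> n z k"

lemma orbit_jacobian_carrier [simp]: "orbit_jacobian T \<gamma> n z k \<in> carrier_mat n n"
  by (induction k) (auto intro: mult_carrier_mat[of _ n n])

lemma det_orbit_jacobian:
  "Determinant.det (orbit_jacobian T \<gamma> n z k)
    = (\<Prod>l<k. Determinant.det (cml_jacobian T \<gamma> n ((cml T \<gamma> n ^^ l) z)))"
  by (induction k) (simp_all add: det_mult[of _ n])

text \<open>
  The chain rule along the orbit: column \<open>j\<close> of the Jacobian is the velocity of the image of the
  \<open>j\<close>-th coordinate line through \<open>z\<close>, which each step multiplies by the Jacobian of that step.
\<close>

lemma jacobian_cml_funpow:
  assumes T: "T ` {0..1} \<subseteq> {0..1}" and \<gamma>: "0 \<le> \<gamma>" "\<gamma> \<le> 1"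
    and z: "z \<in> unit_cube n"
    and diff: "differentiable_along_orbit T \<gamma> n p z"
  shows "jacobian n (cml T \<gamma> n ^^ p) z = orbit_jacobian T \<gamma> n z p"
proof (rule eq_matI)
  fix i j assume "i < dim_row (orbit_jacobian T \<gamma> n z p)" "j < dim_col (orbit_jacobian T \<gamma> n z p)"
  then have i: "i < n" and j: "j < n"
    using orbit_jacobian_carrier[of T \<gamma> n z p] by (auto simp del: orbit_jacobian_carrier)
  let ?s = "vec_index z j"
  let ?c = "\<lambda>k t. (cml T \<gamma> n ^^ k) (update_vec z j t)"
  have zn: "dim_vec z = n" and s: "?s \<in> {0..1}"
    using z j by (auto simp: unit_cube_def)
  have c_s: "?c k ?s = (cml T \<gamma> n ^^ k) z" for k
  proof -
    have "update_vec z j ?s = z"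
      by (rule eq_vecI) (auto simp: update_vec_def)
    then show ?thesis by simp
  qed
  have "update_vec z j t \<in> unit_cube n" if "t \<in> {0..1}" for t
    using z that by (auto simp: unit_cube_def update_vec_def)
  then have cube: "?c k t \<in> unit_cube n" if "t \<in> {0..1}" for k t
    using cml_funpow_unit_cube[OF T \<gamma>] that by blast
  have deriv: "((\<lambda>t. vec_index (?c k t) i) has_real_derivative
      orbit_jacobian T \<gamma> n z k $$ (i, j)) (at ?s within {0..1})" if "k \<le> p" "i < n" for k i
    using that
  proof (induction k arbitrary: i)
    case 0
    have "vec_index (update_vec z j t) i = (if i = j then t else vec_index z i)" for t
      using 0 zn by (simp add: update_vec_def)
    then show ?case using 0 j by auto
  next
    case (Suc k)
    have "((\<lambda>t. vec_index (cml T \<gamma> n (?c k t)) i) has_real_derivative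
        (\<Sum>l<n. cml_jacobian T \<gamma> n (?c k ?s) $$ (i, l) * orbit_jacobian T \<gamma> n z k $$ (l, j)))
        (at ?s within {0..1})"
    proof (rule cml_curve_derivative)
      show "T differentiable at (vec_index (?c k ?s) l) within {0..1}" if "l < n" for l
        unfolding c_s using diff Suc.prems that by (simp add: differentiable_along_orbit_def)
    qed (use Suc cube in auto)
    also have "(\<Sum>l<n. cml_jacobian T \<gamma> n (?c k ?s) $$ (i, l) * orbit_jacobian T \<gamma> n z k $$ (l, j))
        = orbit_jacobian T \<gamma> n z (Suc k) $$ (i, j)"
      unfolding c_s using Suc.prems j
        carrier_matD[OF orbit_jacobian_carrier[of T \<gamma> n z k]]
        carrier_matD[OF cml_jacobian_carrier[of T \<gamma> n "(cml T \<gamma> n ^^ k) z"]]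
      by (simp add: scalar_prod_def lessThan_atLeast0)
    finally show ?case by simp
  qed
  have "vector_derivative (\<lambda>t. vec_index (?c p t) i) (at ?s within {0..1})
      = orbit_jacobian T \<gamma> n z p $$ (i, j)"
    by (rule vector_derivative_within_closed_interval)
       (use deriv[of p i] i s in \<open>auto simp: has_real_derivative_iff_has_vector_derivative\<close>)
  then show "jacobian n (cml T \<gamma> n ^^ p) z $$ (i, j) = orbit_jacobian T \<gamma> n z p $$ (i, j)"
    using i j by (simp add: jacobian_def)
qed (use orbit_jacobian_carrier[of T \<gamma> n z p] in \<open>auto simp: jacobian_def simp del: orbit_jacobian_carrier\<close>)

section \<open>Growth of the determinant with the number of sites\<close>

text \<open>
  There are \<open>n\<close> factors \<open>\<bar>T'\<bar> \<ge> 1 / \<lambda>\<close> against \<open>n - 1\<close> factors \<open>1 - \<gamma>\<close>; one of the former is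
  given up, being at least \<open>1\<close>, to obtain a pure power.
\<close>

lemma det_cml_jacobian_lower_bound:
  assumes T: "piecewise_expanding T \<A>"
    and \<gamma>: "\<gamma> < 1 - contraction_const T \<A>"
    and pos: "0 < contraction_const T \<A>" and n: "0 < n"
    and x: "x \<in> unit_cube n"
    and diff: "\<And>i. i < n \<Longrightarrow> T differentiable (at (vec_index x i) within {0..1})"
  shows "((1 - \<gamma>) / contraction_const T \<A>) ^ (n - 1) \<le> \<bar>Determinant.det (cml_jacobian T \<gamma> n x)\<bar>"
proof -
  let ?l = "contraction_const T \<A>"
  let ?d = "\<lambda>j. vector_derivative T (at (vec_index x j) within {0..1})"
  have l1: "?l < 1" using T by (simp add: piecewise_expanding_def)
  have d: "1 / ?l \<le> \<bar>?d j\<bar>" if "j < n" for j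
  proof -
    have "1 \<le> ?l * \<bar>?d j\<bar>"
    proof (rule piecewise_expanding_derivative[OF T])
      show "vec_index x j \<in> {0..1}" using x that by (simp add: unit_cube_def)
      show "(T has_real_derivative ?d j) (at (vec_index x j) within {0..1})"
        using diff[OF that]
        by (simp add: vector_derivative_works has_real_derivative_iff_has_vector_derivative)
    qed
    then show ?thesis using pos by (simp add: field_simps)
  qed
  have "((1 - \<gamma>) / ?l) ^ (n - 1) = (1 - \<gamma>) ^ (n - 1) * (1 / ?l) ^ (n - 1)"
    by (simp add: power_divide)
  also have "\<dots> \<le> (1 - \<gamma>) ^ (n - 1) * (1 / ?l) ^ n"
    using \<gamma> pos l1 by (intro mult_left_mono power_increasing) auto
  also have "(1 / ?l) ^ n = (\<Prod>j<n. 1 / ?l)" by simp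
  also have "(1 - \<gamma>) ^ (n - 1) * \<dots> \<le> (1 - \<gamma>) ^ (n - 1) * (\<Prod>j<n. \<bar>?d j\<bar>)"
    using \<gamma> pos d by (intro mult_left_mono prod_mono) auto
  also have "\<dots> = \<bar>Determinant.det (cml_jacobian T \<gamma> n x)\<bar>"
    using \<gamma> pos n by (simp add: det_cml_jacobian abs_mult abs_prod)
  finally show ?thesis .
qed

theorem proposition3p2:
  fixes T :: "real \<Rightarrow> real" and \<A> :: "real set set" and \<gamma> :: real and p :: nat
    and z :: "nat \<Rightarrow> real Matrix.vec"
  assumes "piecewise_expanding T \<A>"
    and "0 \<le> \<gamma>" and "\<gamma> \<le> 1" and "\<gamma> < 1 - contraction_const T \<A>"
    and "1 \<le> p"
    and "\<And>n. 2 \<le> n \<Longrightarrow> z n \<in> unit_cube n"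
    and "\<And>n. 2 \<le> n \<Longrightarrow> prime_periodic_point (cml T \<gamma> n) p (z n)"
    and "\<And>n. 2 \<le> n \<Longrightarrow> differentiable_along_orbit T \<gamma> n p (z n)"
  shows "(\<lambda>n. extremal_index T \<gamma> n p (z n)) \<longlonglongrightarrow> 1"
proof -
  let ?l = "contraction_const T \<A>"
  define r where "r = (1 - \<gamma>) / ?l"
  have Timg: "T ` {0..1} \<subseteq> {0..1}"
    using assms(1) by (simp add: piecewise_expanding_def)
  have diff: "T differentiable (at (vec_index ((cml T \<gamma> n ^^ k) (z n)) i) within {0..1})"
    if "2 \<le> n" "k < p" "i < n" for n k i
    using assms(8)[OF that(1)] that by (simp add: differentiable_along_orbit_def)
  \<comment> \<open>The first coordinate of the orbit point for \<open>n = 2\<close> is a point where \<open>T\<close> is differentiable.\<close>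
  have pos: "0 < ?l"
  proof -
    let ?x = "vec_index (z 2) 0"
    have "(T has_real_derivative vector_derivative T (at ?x within {0..1})) (at ?x within {0..1})"
      using diff[of 2 0 0] assms(5)
      by (simp add: vector_derivative_works has_real_derivative_iff_has_vector_derivative)
    moreover have "?x \<in> {0..1}" using assms(6)[of 2] by (simp add: unit_cube_def)
    ultimately have "1 \<le> ?l * \<bar>vector_derivative T (at ?x within {0..1})\<bar>"
      using piecewise_expanding_derivative[OF assms(1)] by blast
    then show ?thesis
      by (smt (verit) mult_nonneg_nonneg mult_nonpos_nonneg abs_ge_zero)
  qed
  have r: "1 < r" using assms(4) pos by (simp add: r_def field_simps)
  have bound: "r ^ (n - 1) \<le> \<bar>Determinant.det (jacobian n (cml T \<gamma> n ^^ p) (z n))\<bar>"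
    if n: "2 \<le> n" for n
  proof -
    have "r ^ (n - 1) = (r ^ (n - 1)) ^ 1" by simp
    also have "\<dots> \<le> (r ^ (n - 1)) ^ p"
      using r assms(5) by (intro power_increasing) (auto intro: one_le_power)
    also have "\<dots> = (\<Prod>k<p. r ^ (n - 1))" by simp
    also have "\<dots> \<le> (\<Prod>k<p. \<bar>Determinant.det (cml_jacobian T \<gamma> n ((cml T \<gamma> n ^^ k) (z n)))\<bar>)"
    proof (rule prod_mono, intro conjI)
      fix k assume "k \<in> {..<p}"
      then show "r ^ (n - 1) \<le> \<bar>Determinant.det (cml_jacobian T \<gamma> n ((cml T \<gamma> n ^^ k) (z n)))\<bar>"
        unfolding r_def
        using n diff cml_funpow_unit_cube[OF Timg assms(2,3) assms(6)[OF n]]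
        by (intro det_cml_jacobian_lower_bound[OF assms(1,4) pos]) auto
    qed (use r in auto)
    also have "\<dots> = \<bar>Determinant.det (jacobian n (cml T \<gamma> n ^^ p) (z n))\<bar>"
      using jacobian_cml_funpow[OF Timg assms(2,3) assms(6)[OF n] assms(8)[OF n]]
      by (simp add: det_orbit_jacobian abs_prod)
    finally show ?thesis .
  qed
  have "(\<lambda>n. 1 / \<bar>Determinant.det (jacobian n (cml T \<gamma> n ^^ p) (z n))\<bar>) \<longlonglongrightarrow> 0"
  proof (rule tendsto_sandwich[OF _ _ tendsto_const])
    show "\<forall>\<^sub>F n in sequentially. 1 / \<bar>Determinant.det (jacobian n (cml T \<gamma> n ^^ p) (z n))\<bar>
        \<le> r * (1 / r) ^ n"
      using eventually_ge_at_top[of 2]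
    proof eventually_elim
      case (elim n)
      have "1 / \<bar>Determinant.det (jacobian n (cml T \<gamma> n ^^ p) (z n))\<bar> \<le> 1 / r ^ (n - 1)"
        using bound[OF elim] r by (intro frac_le) auto
      also have "\<dots> = r * (1 / r) ^ n"
        using r elim by (cases n) (auto simp: power_divide)
      finally show ?case .
    qed
    show "(\<lambda>n. r * (1 / r) ^ n) \<longlonglongrightarrow> 0"
      using r by (intro tendsto_mult_right_zero LIMSEQ_power_zero) auto
  qed auto
  from tendsto_diff[OF tendsto_const[of 1] this] show ?thesis
    by (simp add: extremal_index_def)
qed

end
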